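(* Let $\lambda$ be a nonzero real number and let $Y$ be the gamma random variable with parameters $\alpha,\beta>0$, i.e. with density $f(y)=\beta e^{-\beta y}\frac{(\beta y)^{\alpha-1}}{\Gamma(\alpha)}$ for $y\ge0$ and $f(y)=0$ for $y<0$. Then, for all integers $n\ge k\ge 0$, $$S_{2}^{Y}(n,k)=\frac{1}{k!\, \beta^{n}}\sum_{j=0}^{k}\binom{k}{j}(-1)^{k-j}(\alpha j+n-1)_{n},$$ $$S_{1}^{Y}(n,k)=\frac{1}{k!}\beta^{k}\Big(-\frac{1}{\alpha} \Big)^{n}\sum_{j=0}^{k}\binom{k}{j}(-1)^{j}\big(j+(n-1)\alpha \big)_{n,\alpha},$$ $$S_{2,\lambda}^{Y}(n,k)=\sum_{l=0}^{n}\sum_{j=0}^{k}(-1)^{k-j}\frac{1}{k!}\binom{k}{j}(\alpha j+l-1)_{l}\frac{1}{\beta^{l}}\lambda^{n-l}S_{1}(n,l),$$ $$S_{1,\lambda}^{Y}(n,k)=\sum_{l=k}^{n}\sum_{j=0}^{l}S_{2}(l,k)\binom{l}{j}\frac{1}{l!}(-1)^{n-j}\lambda^{l-k}\beta^{l}\frac{1}{\alpha^{n}}\big(j+(n-1)\alpha \big)_{n,\alpha}.$$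
   Context: Classical notions. $(x)_0=1$, $(x)_n=x(x-1)\cdots(x-n+1)$ for $n\ge1$. For any nonzero real $c$ (used with $c=\lambda$ and $c=\alpha$): $(x)_{0,c}=1$, $(x)_{n,c}=x(x-c)\cdots(x-(n-1)c)$ for $n\ge1$. $S_2(n,k)$ and $S_1(n,k)$ are the Stirling numbers of the second kind and the (signed) Stirling numbers of the first kind: $\frac{1}{k!}(e^t-1)^k=\sum_{n\ge k}S_2(n,k)\frac{t^n}{n!}$, $\frac{1}{k!}(\log(1+t))^k=\sum_{n\ge k}S_1(n,k)\frac{t^n}{n!}$. For nonzero real $\lambda$: $e_\lambda^x(t)=(1+\lambda t)^{x/\lambda}=\sum_{n\ge0}(x)_{n,\lambda}\frac{t^n}{n!}$. Probabilistic versions. For a random variable $Y$ whose moment generating function exists near $0$ and with $E[Y]\ne0$, put $e_Y(t)=E[e^{Yt}]-1=\sum_{n\ge1}E[Y^n]\frac{t^n}{n!}$ and $e_{Y,\lambda}(t)=E[e_\lambda^Y(t)]-1=\sum_{n\ge1}E[(Y)_{n,\lambda}]\frac{t^n}{n!}$ (power series in $t$), and let $\bar e_Y(t)$, $\bar e_{Y,\lambda}(t)$ be their compositional inverses. Then for $k\ge0$: $\frac{1}{k!}(e_Y(t))^k=\sum_{n\ge k}S_2^Y(n,k)\frac{t^n}{n!}$, $\frac{1}{k!}(\bar e_Y(t))^k=\sum_{n\ge k}S_1^Y(n,k)\frac{t^n}{n!}$, $\frac{1}{k!}(e_{Y,\lambda}(t))^k=\sum_{n\ge k}S_{2,\lambda}^Y(n,k)\frac{t^n}{n!}$,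 $\frac{1}{k!}(\bar e_{Y,\lambda}(t))^k=\sum_{n\ge k}S_{1,\lambda}^Y(n,k)\frac{t^n}{n!}$ define the probabilistic (degenerate) Stirling numbers associated with $Y$. *)

theory Defs
  imports
    "HOL-Probability.Probability"
    "HOL-Computational_Algebra.Formal_Power_Series"
    "HOL-Combinatorics.Stirling"
begin

text \<open>
  The generalized falling factorial \<open>(x)\<^sub>n\<^sub>,\<^sub>c = x (x - c) \<dots> (x - (n - 1) c)\<close>.
\<close>

definition falling_step :: "real \<Rightarrow> real \<Rightarrow> nat \<Rightarrow> real" where
  "falling_step c x n = (\<Prod>i<n. x - real i * c)"

abbreviation falling :: "real \<Rightarrow> nat \<Rightarrow> real" where
  "falling x n \<equiv> falling_step 1 x n"

text \<open>The number \<open>a\<^sub>n\<close> for which \<open>F(t)\<^sup>k / k! = \<Sum>\<^sub>n a\<^sub>n t\<^sup>n / n!\<close>.\<close>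

definition stirling_coeff :: "real fps \<Rightarrow> nat \<Rightarrow> nat \<Rightarrow> real" where
  "stirling_coeff F n k = fact n * fps_nth (fps_const (1 / fact k) * F ^ k) n"

text \<open>
  The library numbers \<open>stirling\<close> are the unsigned ones of the first kind.  The two
  generating functions that characterize the classical numbers are proved below.
\<close>

definition S2 :: "nat \<Rightarrow> nat \<Rightarrow> real" where
  "S2 n k = real (Stirling n k)"

definition S1 :: "nat \<Rightarrow> nat \<Rightarrow> real" where
  "S1 n k = (- 1) ^ (n - k) * real (stirling n k)"

lemma fps_deriv_power_divide_fact:
  fixes F :: "real fps"
  shows "fps_deriv (fps_const (1 / fact (Suc m)) * F ^ Suc m)
           = fps_deriv F * (fps_const (1 / fact m) * F ^ m)"
proof -
  have "fps_deriv (F ^ Suc m) = fps_const (real (Suc m)) * (fps_deriv F * F ^ m)"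
    unfolding fps_deriv_power by (simp only: diff_Suc_1 mult.assoc)
  then have "fps_deriv (fps_const (1 / fact (Suc m)) * F ^ Suc m)
      = (fps_const (1 / fact (Suc m)) * fps_const (real (Suc m))) * (fps_deriv F * F ^ m)"
    by (simp only: fps_deriv_mult_const_left mult.assoc)
  also have "fps_const (1 / fact (Suc m)) * fps_const (real (Suc m)) = fps_const (1 / fact m :: real)"
    unfolding fps_const_mult by (simp del: of_nat_Suc)
  finally show ?thesis by (simp only: mult.left_commute)
qed

lemma S2_egf: "S2 n k = stirling_coeff (fps_exp 1 - 1) n k"
proof (induction n arbitrary: k)
  case 0
  show ?case by (cases k) (simp_all add: S2_def stirling_coeff_def)
next
  case (Suc n)
  show ?case
  proof (cases k)
    case 0
    then show ?thesis by (simp add: S2_def stirling_coeff_def)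
  next
    case (Suc m)
    let ?E = "fps_exp 1 - 1 :: real fps"
    let ?F = "\<lambda>j. fps_const (1 / fact j) * ?E ^ j"
    have "fps_deriv (?F (Suc m)) = (?E + 1) * ?F m"
      unfolding fps_deriv_power_divide_fact by simp
    also have "\<dots> = ?E * ?F m + ?F m" by (simp only: distrib_right mult_1_left)
    also have "?E * ?F m = fps_const (real (Suc m)) * ?F (Suc m)"
    proof -
      have "fps_const (real (Suc m)) * fps_const (1 / fact (Suc m)) = fps_const (1 / fact m :: real)"
        unfolding fps_const_mult by (simp del: of_nat_Suc)
      then show ?thesis
        by (simp only: mult.assoc[symmetric]) (simp only: power_Suc mult_ac)
    qed
    finally have "fps_nth (fps_deriv (?F (Suc m))) n
        = real (Suc m) * fps_nth (?F (Suc m)) n + fps_nth (?F m) n"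
      by (simp only: fps_add_nth fps_mult_left_const_nth)
    then have "real (Suc n) * fps_nth (?F (Suc m)) (Suc n)
        = real (Suc m) * fps_nth (?F (Suc m)) n + fps_nth (?F m) n"
      by (simp only: fps_deriv_nth Suc_eq_plus1)
    then have "stirling_coeff ?E (Suc n) (Suc m)
        = real (Suc m) * stirling_coeff ?E n (Suc m) + stirling_coeff ?E n m"
      unfolding stirling_coeff_def fact_Suc
      by (simp only: mult.assoc of_nat_mult mult.left_commute[of "real (Suc n)"]) (simp only: algebra_simps)
    then show ?thesis using Suc.IH[of m] Suc.IH[of "Suc m"] Suc
      by (simp add: S2_def algebra_simps)
  qed
qed

lemma S1_egf: "S1 n k = stirling_coeff (fps_ln 1) n k"
proof (induction n arbitrary: k)
  case 0
  show ?case by (cases k) (simp_all add: S1_def stirling_coeff_def)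
next
  case (Suc n)
  show ?case
  proof (cases k)
    case 0
    then show ?thesis by (simp add: S1_def stirling_coeff_def)
  next
    case (Suc m)
    let ?L = "fps_ln 1 :: real fps"
    let ?F = "\<lambda>j. fps_const (1 / fact j) * ?L ^ j"
    have inv: "(1 + fps_X) * fps_deriv ?L = 1"
      by (simp add: fps_ln_deriv inverse_mult_eq_1')
    have "(1 + fps_X) * fps_deriv (?F (Suc m)) = ?F m"
      unfolding fps_deriv_power_divide_fact by (simp only: mult.assoc[symmetric] inv mult_1_left)
    then have "fps_nth ((1 + fps_X) * fps_deriv (?F (Suc m))) n = fps_nth (?F m) n"
      by (rule arg_cong)
    then have "real (Suc n) * fps_nth (?F (Suc m)) (Suc n) + real n * fps_nth (?F (Suc m)) n
        = fps_nth (?F m) n"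
      by (cases n) (simp_all only: distrib_right fps_add_nth mult_1_left fps_X_mult_nth fps_deriv_nth, simp_all)
    then have "stirling_coeff ?L (Suc n) (Suc m)
        = stirling_coeff ?L n m - real n * stirling_coeff ?L n (Suc m)"
      unfolding stirling_coeff_def
    proof -
      have "a * f * x = f * z - b * (f * y)" if "a * x + b * y = z" for a b f x y z :: real
        using that by (auto simp: algebra_simps)
      then show "fact (Suc n) * fps_nth (?F (Suc m)) (Suc n)
          = fact n * fps_nth (?F m) n - real n * (fact n * fps_nth (?F (Suc m)) n)"
        if "real (Suc n) * fps_nth (?F (Suc m)) (Suc n) + real n * fps_nth (?F (Suc m)) n
          = fps_nth (?F m) n"
        using that unfolding fact_Suc[of n] by blast
    qed
    moreover have "S1 (Suc n) (Suc m) = S1 n m - real n * S1 n (Suc m)"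
    proof (cases "m < n")
      case True
      then have "n - m = Suc (n - Suc m)" by simp
      then show ?thesis by (simp add: S1_def algebra_simps)
    next
      case False
      then show ?thesis by (simp add: S1_def)
    qed
    ultimately show ?thesis using Suc.IH[of m] Suc.IH[of "Suc m"] Suc by simp
  qed
qed

text \<open>
  \<open>e\<^sub>Y(t) = E[exp (Y t)] - 1\<close> and \<open>e\<^sub>Y\<^sub>,\<^sub>\<lambda>(t) = E[(1 + \<lambda> t) powr (Y / \<lambda>)] - 1\<close>, each as the power
  series in \<open>t\<close> obtained by taking expectations of the coefficients.  They are
  meaningful for \<open>Y\<close> whose moment generating function exists near \<open>0\<close>.
\<close>

definition e_Y :: "'a measure \<Rightarrow> ('a \<Rightarrow> real) \<Rightarrow> real fps" where
  "e_Y M Y = Abs_fps (\<lambda>n. if n = 0 then 0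
     else integral\<^sup>L M (\<lambda>\<omega>. Y \<omega> ^ n) / fact n)"

definition e_Y_deg :: "'a measure \<Rightarrow> ('a \<Rightarrow> real) \<Rightarrow> real \<Rightarrow> real fps" where
  "e_Y_deg M Y l = Abs_fps (\<lambda>n. if n = 0 then 0
     else integral\<^sup>L M (\<lambda>\<omega>. falling_step l (Y \<omega>) n) / fact n)"

text \<open>
  \<open>fps_inv\<close> is the compositional inverse; it is a true inverse here as the constant
  coefficients vanish and the linear ones are \<open>E[Y] \<noteq> 0\<close>.
\<close>

definition S2_prob :: "'a measure \<Rightarrow> ('a \<Rightarrow> real) \<Rightarrow> nat \<Rightarrow> nat \<Rightarrow> real" where
  "S2_prob M Y = stirling_coeff (e_Y M Y)"

definition S1_prob :: "'a measure \<Rightarrow> ('a \<Rightarrow> real) \<Rightarrow> nat \<Rightarrow> nat \<Rightarrow> real" where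
  "S1_prob M Y = stirling_coeff (fps_inv (e_Y M Y))"

definition S2_prob_deg :: "'a measure \<Rightarrow> ('a \<Rightarrow> real) \<Rightarrow> real \<Rightarrow> nat \<Rightarrow> nat \<Rightarrow> real" where
  "S2_prob_deg M Y l = stirling_coeff (e_Y_deg M Y l)"

definition S1_prob_deg :: "'a measure \<Rightarrow> ('a \<Rightarrow> real) \<Rightarrow> real \<Rightarrow> nat \<Rightarrow> nat \<Rightarrow> real" where
  "S1_prob_deg M Y l = stirling_coeff (fps_inv (e_Y_deg M Y l))"

text \<open>
  At the single point \<open>y = 0\<close> the value depends on the convention \<open>0 powr a = 0\<close>;
  this does not affect the distribution.
\<close>

definition gamma_density :: "real \<Rightarrow> real \<Rightarrow> real \<Rightarrow> real" where
  "gamma_density \<alpha> \<beta> y =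
     (if y < 0 then 0 else \<beta> * exp (- \<beta> * y) * (\<beta> * y) powr (\<alpha> - 1) / Gamma \<alpha>)"

end

theory Submission
  imports Defs
begin

text \<open>
  The gamma distribution has moments \<open>E[Y^m] = \<alpha>(\<alpha> + 1)\<cdots>(\<alpha> + m - 1) / \<beta>^m\<close>, so the binomial series
  identifies \<open>e\<^sub>Y(t) = (1 - t/\<beta>) powr (-\<alpha>) - 1\<close>. This is the series \<open>(1 + t) powr (-\<alpha>) - 1\<close> with its
  argument rescaled by \<open>-1/\<beta>\<close>.

  Everything about \<open>(1 + t) powr a - 1\<close> is explicit. Its powers expand by the binomial theorem into
  combinations of \<open>(1 + t) powr (a j)\<close>, whose coefficients are falling factorials
  (\<open>stirling_coeff_binomial\<close>). Its compositional inverse is \<open>(1 + t) powr (1/a) - 1\<close>, because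
  \<open>((1 + t) powr b) powr a = (1 + t) powr (a b)\<close> (\<open>fps_binomial_compose\<close>). These two facts give the
  formulas for \<open>S\<^sub>2\<^sup>Y\<close> and, after solving for \<open>t\<close>, for \<open>S\<^sub>1\<^sup>Y\<close>.

  For the degenerate numbers, let \<open>L(t) = log(1 + \<lambda> t)/\<lambda>\<close>. Expanding \<open>(y)\<^sub>n\<^sub>,\<^sub>\<lambda>\<close> in powers of \<open>y\<close> with
  Stirling numbers of the first kind and taking expectations gives \<open>e\<^sub>Y\<^sub>,\<^sub>\<lambda> = e\<^sub>Y \<circ> L\<close>
  (\<open>e_Y_deg_eq_compose\<close>). Hence the inverse of \<open>e\<^sub>Y\<^sub>,\<^sub>\<lambda>\<close> is the inverse of \<open>e\<^sub>Y\<close> followed by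
  \<open>t \<mapsto> (exp(\<lambda> t) - 1)/\<lambda>\<close>. The numbers attached to a composition are the matrix product of the
  numbers attached to the two factors (\<open>stirling_coeff_compose\<close>), and the two remaining formulas are
  such products with the classical Stirling numbers.
\<close>

section \<open>Generating functions under rescaling and composition\<close>

text \<open>
  The series \<open>a F(b t)\<close>. The parameters \<open>\<beta>\<close> and \<open>\<lambda>\<close> enter the generating functions only through such
  rescalings of \<open>(1 + t) powr c - 1\<close>, \<open>exp t - 1\<close> and \<open>log (1 + t)\<close>.
\<close>

definition fps_scale :: "real \<Rightarrow> real \<Rightarrow> real fps \<Rightarrow> real fps" where
  "fps_scale a b F = fps_const a * (F oo (fps_const b * fps_X))"

lemma fps_scale_nth [simp]: "fps_nth (fps_scale a b F) n = a * b ^ n * fps_nth F n"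
  by (simp add: fps_scale_def)

lemma stirling_coeff_scale:
  "stirling_coeff (fps_scale a b F) n k = a ^ k * b ^ n * stirling_coeff F n k"
proof -
  have "fps_scale a b F ^ k = fps_const (a ^ k) * (F ^ k oo (fps_const b * fps_X))"
    by (simp add: fps_scale_def power_mult_distrib fps_const_power fps_compose_power)
  then show ?thesis
    by (simp add: stirling_coeff_def)
qed

lemma fps_scale_compose_scale:
  assumes "fps_nth G 0 = 0" and "b \<noteq> 0"
  shows "fps_scale a b F oo fps_scale (1 / b) d G = fps_scale a d (F oo G)"
proof -
  let ?S = "fps_scale (1 / b) d G"
  have S0: "fps_nth ?S 0 = 0"
    using assms by simp
  have "(fps_const b * fps_X) oo ?S = fps_const b * ?S"
    using S0 by (simp add: fps_compose_mult_distrib)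
  also have "\<dots> = G oo (fps_const d * fps_X)"
    using assms by (simp add: fps_scale_def fps_eq_iff)
  finally have inner: "(fps_const b * fps_X) oo ?S = G oo (fps_const d * fps_X)" .
  have "fps_scale a b F oo ?S = fps_const a * (F oo (fps_const b * fps_X) oo ?S)"
    using S0 by (simp add: fps_scale_def fps_compose_mult_distrib)
  also have "F oo (fps_const b * fps_X) oo ?S = F oo ((fps_const b * fps_X) oo ?S)"
    using S0 by (simp add: fps_compose_assoc)
  also have "\<dots> = F oo G oo (fps_const d * fps_X)"
    unfolding inner using assms by (simp add: fps_compose_assoc)
  finally show ?thesis
    by (simp add: fps_scale_def)
qed

lemma fps_scale_X: "a * b = 1 \<Longrightarrow> fps_scale a b fps_X = fps_X"
  by (simp add: fps_eq_iff)

text \<open>The coefficient of \<open>t^n\<close> in \<open>F(G(t))^k\<close> collects \<open>[u^l] F(u)^k\<close> times \<open>[t^n] G(t)^l\<close>.\<close>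

lemma stirling_coeff_compose:
  assumes "fps_nth G 0 = 0"
  shows "stirling_coeff (F oo G) n k = (\<Sum>l=0..n. stirling_coeff F l k * stirling_coeff G n l)"
proof -
  have "fps_nth ((F oo G) ^ k) n = (\<Sum>l=0..n. fps_nth (F ^ k) l * fps_nth (G ^ l) n)"
    using assms by (simp add: fps_compose_power fps_compose_nth)
  then show ?thesis
    by (simp add: stirling_coeff_def sum_distrib_left sum_divide_distrib mult_ac)
qed

lemma stirling_coeff_eq_0:
  assumes "fps_nth F 0 = 0" and "n < k"
  shows "stirling_coeff F n k = 0"
  using assms startsby_zero_power_prefix[of F k] by (simp add: stirling_coeff_def)

lemma fps_inv_unique:
  fixes F G :: "real fps"
  assumes "G oo F = fps_X" and "fps_nth F 0 = 0" and "fps_nth F 1 \<noteq> 0"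
  shows "fps_inv F = G"
proof -
  have inv0: "fps_nth (fps_inv F) 0 = 0"
    by (simp add: fps_inv_def)
  have "fps_inv F = (G oo F) oo fps_inv F"
    using assms inv0 by simp
  also have "\<dots> = G oo (F oo fps_inv F)"
    using assms inv0 by (simp add: fps_compose_assoc)
  also have "\<dots> = G"
    using assms by (simp add: fps_inv_right del: One_nat_def)
  finally show ?thesis .
qed

section \<open>Binomial series\<close>

text \<open>
  Both sides satisfy the equation \<open>(1 + t) f' = a b f\<close>, which together with \<open>f(0) = 1\<close> determines the
  binomial series.
\<close>

lemma fps_binomial_compose:
  "fps_binomial a oo (fps_binomial b - 1) = (fps_binomial (a * b) :: real fps)"
proof -
  let ?G = "fps_binomial b - 1 :: real fps"
  let ?f = "fps_binomial a oo ?G"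
  let ?d = "fps_deriv (fps_binomial a) oo ?G"
  have X0: "(1 + fps_X :: real fps) \<noteq> 0"
    by (metis add.right_neutral fps_X_nth fps_add_nth fps_one_nth fps_zero_nth zero_neq_one)
  have ode: "(1 + fps_X) * fps_deriv (fps_binomial c) = fps_const c * fps_binomial c" for c :: real
  proof -
    have "is_unit (1 + fps_X :: real fps)"
      by simp
    then show ?thesis
      unfolding fps_binomial_deriv by (metis dvd_mult_div_cancel unit_imp_dvd)
  qed
  have "((1 + fps_X) * fps_deriv (fps_binomial a)) oo ?G = (1 + ?G) * ?d"
    by (simp add: fps_compose_mult_distrib fps_compose_add_distrib)
  moreover have "((1 + fps_X) * fps_deriv (fps_binomial a)) oo ?G = fps_const a * ?f"
    unfolding ode by (simp add: fps_compose_mult_distrib)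
  ultimately have outer: "fps_binomial b * ?d = fps_const a * ?f"
    by simp
  have "(1 + fps_X) * fps_deriv ?f = ?d * ((1 + fps_X) * fps_deriv (fps_binomial b))"
    by (simp add: fps_compose_deriv mult_ac)
  also have "\<dots> = fps_const b * (fps_binomial b * ?d)"
    unfolding ode by (simp add: mult_ac)
  also have "\<dots> = fps_const (a * b) * ?f"
    unfolding outer by (simp add: mult_ac flip: fps_const_mult)
  finally have "fps_deriv ?f = fps_const (a * b) * ?f / (1 + fps_X)"
    using X0 by (metis nonzero_mult_div_cancel_left)
  then show ?thesis
    by (simp flip: fps_binomial_ODE_unique')
qed

lemma fps_binomial_nth_falling: "fact n * fps_nth (fps_binomial a) n = falling a n"
  by (simp add: gbinomial_prod_rev falling_step_def atLeast0LessThan)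

text \<open>By the binomial theorem, since \<open>((1 + t) powr a)^j = (1 + t) powr (a j)\<close>.\<close>

lemma stirling_coeff_binomial:
  "stirling_coeff (fps_binomial a - 1) n k =
     1 / fact k * (\<Sum>j=0..k. real (k choose j) * (- 1) ^ (k - j) * falling (a * real j) n)"
proof -
  have "(fps_binomial a - 1) ^ k = (fps_binomial a + fps_const (- 1)) ^ k"
    by (simp flip: fps_const_neg)
  also have "\<dots> = (\<Sum>j\<le>k. fps_const (real (k choose j) * (- 1) ^ (k - j)) * fps_binomial (a * real j))"
    unfolding binomial_ring
    by (intro sum.cong)
       (simp_all add: fps_binomial_power fps_const_power fps_of_nat mult_ac flip: fps_const_mult)
  finally have "fact n * fps_nth ((fps_binomial a - 1) ^ k) n =
      (\<Sum>j\<le>k. real (k choose j) * (- 1) ^ (k - j) * (fact n * fps_nth (fps_binomial (a * real j)) n))"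
    by (simp add: fps_sum_nth sum_distrib_left mult_ac del: fps_binomial_nth)
  then show ?thesis
    unfolding fps_binomial_nth_falling
    by (simp add: stirling_coeff_def atLeast0AtMost del: fps_binomial_nth)
qed

section \<open>Falling factorials\<close>

text \<open>Reversing the order of the factors turns a rising product with step \<open>c\<close> into a falling one.\<close>

lemma falling_step_reflect:
  assumes "c \<noteq> 0"
  shows "falling_step c (x + (real n - 1) * c) n = (- c) ^ n * falling (- (x / c)) n"
proof -
  have "falling_step c (x + (real n - 1) * c) n = (\<Prod>i<n. x + real (n - Suc i) * c)"
    unfolding falling_step_def
    by (intro prod.cong) (simp_all add: algebra_simps of_nat_diff)
  also have "\<dots> = (\<Prod>i<n. x + real i * c)"
    by (rule prod.nat_diff_reindex)
  also have "\<dots> = (\<Prod>i<n. (- c) * (- (x / c) - real i * 1))"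
    using assms by (intro prod.cong) (simp_all add: field_simps)
  also have "\<dots> = (- c) ^ n * falling (- (x / c)) n"
    by (simp only: prod.distrib prod_constant falling_step_def card_lessThan)
  finally show ?thesis .
qed

lemma falling_reflect: "falling (x + real n - 1) n = (- 1) ^ n * falling (- x) n"
  using falling_step_reflect[of 1 x n] by (simp add: add_diff_eq)

lemma pochhammer_eq_falling: "pochhammer x n = (- 1) ^ n * falling (- x) n" for x :: real
proof -
  have "pochhammer x n = (\<Prod>i<n. (- 1) * (- x - real i * 1))"
    by (simp add: pochhammer_prod atLeast0LessThan add.commute)
  then show ?thesis
    by (simp only: prod.distrib prod_constant falling_step_def card_lessThan)
qed

text \<open>
  Taking a factor \<open>-c\<close> out of each term leaves the rising factorial of \<open>-y/c\<close>, whose coefficients are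
  the unsigned Stirling numbers; the powers of \<open>-1\<close> combine to the sign in \<open>S1\<close>.
\<close>

lemma falling_step_eq_sum_S1:
  assumes "c \<noteq> 0"
  shows "falling_step c y n = (\<Sum>l=0..n. c ^ (n - l) * S1 n l * y ^ l)"
proof -
  have "falling_step c y n = (\<Prod>i<n. (- c) * (- (y / c) + real i))"
    unfolding falling_step_def using assms by (intro prod.cong) (simp_all add: field_simps)
  also have "\<dots> = (- c) ^ n * pochhammer (- (y / c)) n"
    by (simp only: prod.distrib prod_constant card_lessThan pochhammer_prod atLeast0LessThan)
  also have "\<dots> = (\<Sum>l\<le>n. (- c) ^ n * (real (stirling n l) * (- (y / c)) ^ l))"
    by (simp add: stirling_pochhammer[symmetric] sum_distrib_left)
  also have "\<dots> = (\<Sum>l\<le>n. c ^ (n - l) * S1 n l * y ^ l)"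
  proof (intro sum.cong refl)
    fix l assume "l \<in> {..n}"
    then have "(- c) ^ n = (- c) ^ (n - l) * (- c) ^ l"
      by (simp flip: power_add)
    moreover have "(- c) ^ l * (- (y / c)) ^ l = y ^ l"
      using assms by (simp flip: power_mult_distrib)
    moreover have "(- c) ^ (n - l) = c ^ (n - l) * (- 1) ^ (n - l)"
      by (simp flip: power_mult_distrib)
    ultimately show "(- c) ^ n * (real (stirling n l) * (- (y / c)) ^ l) = c ^ (n - l) * S1 n l * y ^ l"
      by (simp add: S1_def mult_ac)
  qed
  finally show ?thesis
    by (simp add: atLeast0AtMost)
qed

section \<open>The degenerate exponential as a composition\<close>

abbreviation deg_log :: "real \<Rightarrow> real fps" where
  "deg_log c \<equiv> fps_scale (1 / c) c (fps_ln 1)"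

lemma stirling_coeff_deg_log:
  assumes "c \<noteq> 0"
  shows "stirling_coeff (deg_log c) n l = c ^ (n - l) * S1 n l"
proof (cases "l \<le> n")
  case True
  with assms show ?thesis
    by (simp add: stirling_coeff_scale S1_egf power_diff power_divide field_simps)
next
  case False
  then show ?thesis
    by (simp add: stirling_coeff_scale S1_egf[symmetric]) (simp add: S1_def)
qed

text \<open>
  Formally \<open>(1 + c t) powr (Y/c) = exp (Y L(t))\<close> with \<open>L(t) = log(1 + c t)/c\<close>. On coefficients this is
  the expansion of \<open>(Y)\<^sub>n\<^sub>,\<^sub>c\<close> in powers of \<open>Y\<close>, so finite moments suffice.
\<close>

lemma e_Y_deg_eq_compose:
  assumes "c \<noteq> 0" and int: "\<And>m. integrable M (\<lambda>\<omega>. Y \<omega> ^ m)"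
  shows "e_Y_deg M Y c = e_Y M Y oo deg_log c"
proof (rule fps_ext)
  fix n
  show "fps_nth (e_Y_deg M Y c) n = fps_nth (e_Y M Y oo deg_log c) n"
  proof (cases n)
    case 0
    then show ?thesis
      by (simp add: e_Y_deg_def e_Y_def)
  next
    case (Suc m)
    have coeff1: "stirling_coeff F l 1 = fact l * fps_nth F l" for F l
      by (simp add: stirling_coeff_def)
    have "stirling_coeff (e_Y_deg M Y c) n 1 =
        (\<integral>\<omega>. (\<Sum>l=0..n. c ^ (n - l) * S1 n l * Y \<omega> ^ l) \<partial>M)"
      using Suc by (simp only: coeff1) (simp add: e_Y_deg_def falling_step_eq_sum_S1[OF assms(1)])
    also have "\<dots> = (\<Sum>l=0..n. c ^ (n - l) * S1 n l * (\<integral>\<omega>. Y \<omega> ^ l \<partial>M))"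
      using int by (simp add: Bochner_Integration.integral_sum)
    also have "\<dots> = (\<Sum>l=0..n. stirling_coeff (e_Y M Y) l 1 * stirling_coeff (deg_log c) n l)"
    proof (intro sum.cong refl)
      fix l
      \<comment> \<open>The constant term of \<open>e\<^sub>Y\<close> is set to 0, which agrees here because \<open>S1 n 0 = 0\<close> for \<open>n > 0\<close>.\<close>
      show "c ^ (n - l) * S1 n l * (\<integral>\<omega>. Y \<omega> ^ l \<partial>M) =
          stirling_coeff (e_Y M Y) l 1 * stirling_coeff (deg_log c) n l"
        unfolding coeff1 stirling_coeff_deg_log[OF assms(1)]
        using Suc by (cases l) (simp_all add: e_Y_def S1_def)
    qed
    also have "\<dots> = stirling_coeff (e_Y M Y oo deg_log c) n 1"
      by (rule stirling_coeff_compose[symmetric]) simp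
    finally show ?thesis
      unfolding coeff1 by simp
  qed
qed

text \<open>The inverse of \<open>log(1 + c t)/c\<close> is \<open>(exp(c t) - 1)/c\<close>.\<close>

lemma fps_inv_compose_deg_log:
  fixes F :: "real fps"
  assumes "c \<noteq> 0" and F0: "fps_nth F 0 = 0" and F1: "fps_nth F 1 \<noteq> 0"
  shows "fps_inv (F oo deg_log c) = fps_scale (1 / c) c (fps_exp 1 - 1) oo fps_inv F"
proof (rule fps_inv_unique)
  let ?E = "fps_scale (1 / c) c (fps_exp 1 - 1)"
  have inv0: "fps_nth (fps_inv F) 0 = 0"
    by (simp add: fps_inv_def)
  have "fps_exp 1 - 1 oo fps_ln 1 = (fps_X :: real fps)"
    by (simp add: fps_ln_fps_exp_inv fps_inv_right)
  then have EL: "?E oo deg_log c = fps_X"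
    using assms(1) by (simp add: fps_scale_compose_scale fps_scale_X)
  have "?E oo fps_inv F oo (F oo deg_log c) = ?E oo (fps_inv F oo F oo deg_log c)"
    using F0 inv0 by (simp add: fps_compose_assoc)
  then show "?E oo fps_inv F oo (F oo deg_log c) = fps_X"
    using F0 F1 EL by (simp add: fps_inv del: One_nat_def)
  show "fps_nth (F oo deg_log c) 0 = 0"
    using F0 by simp
  show "fps_nth (F oo deg_log c) 1 \<noteq> 0"
    using F0 F1 assms(1) by (simp add: fps_compose_nth fps_ln_nth)
qed

section \<open>The gamma distribution\<close>

lemma gamma_density_nonneg:
  "\<alpha> > 0 \<Longrightarrow> \<beta> > 0 \<Longrightarrow> gamma_density \<alpha> \<beta> y \<ge> 0"
  using Gamma_real_pos[of \<alpha>] by (simp add: gamma_density_def)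

text \<open>The substitution \<open>t = \<beta> y\<close> reduces the moment to Euler's integral for \<open>\<Gamma>(\<alpha> + m)\<close>.\<close>

lemma has_bochner_integral_gamma_density_power:
  assumes \<alpha>: "\<alpha> > 0" and \<beta>: "\<beta> > 0"
  shows "has_bochner_integral lborel (\<lambda>y. gamma_density \<alpha> \<beta> y * y ^ m) (pochhammer \<alpha> m / \<beta> ^ m)"
proof (rule has_bochner_integral_nn_integral)
  let ?f = "\<lambda>t::real. indicator {0..} t * t powr (\<alpha> + real m - 1) / exp t"
  let ?K = "\<beta> ^ m * Gamma \<alpha> / \<beta>"
  have \<Gamma>: "Gamma \<alpha> > 0" and \<Gamma>m: "Gamma (\<alpha> + real m) > 0"
    using \<alpha> by (simp_all add: Gamma_real_pos)
  have K: "?K > 0"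
    using \<Gamma> \<beta> by simp
  show "(\<lambda>y. gamma_density \<alpha> \<beta> y * y ^ m) \<in> borel_measurable lborel"
    unfolding gamma_density_def by measurable
  show "AE y in lborel. 0 \<le> gamma_density \<alpha> \<beta> y * y ^ m"
  proof (rule AE_I2)
    fix y :: real
    show "0 \<le> gamma_density \<alpha> \<beta> y * y ^ m"
      using gamma_density_nonneg[OF \<alpha> \<beta>, of y]
      by (cases "y < 0") (simp add: gamma_density_def, intro mult_nonneg_nonneg, simp_all)
  qed
  show "0 \<le> pochhammer \<alpha> m / \<beta> ^ m"
    using \<alpha> \<beta> by (simp add: pochhammer_nonneg)
  \<comment> \<open>At \<open>y = 0\<close> both sides vanish, because \<open>0 powr a = 0\<close> for every exponent.\<close>
  have point: "?f (0 + \<beta> * y) = ?K * (gamma_density \<alpha> \<beta> y * y ^ m)" for y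
  proof (cases "y > 0")
    case True
    then have "(\<beta> * y) powr (\<alpha> + real m - 1) = (\<beta> * y) powr (\<alpha> - 1) * (\<beta> * y) ^ m"
      using \<beta> powr_add[of "\<beta> * y" "\<alpha> - 1" "real m"] powr_realpow[of "\<beta> * y" m]
      by (simp add: algebra_simps)
    with True \<beta> \<Gamma> show ?thesis
      by (simp add: gamma_density_def exp_minus field_simps power_mult_distrib)
  next
    case False
    with \<beta> show ?thesis
      by (cases "y = 0") (auto simp: gamma_density_def zero_le_mult_iff)
  qed
  have "ennreal (Gamma (\<alpha> + real m)) = (\<integral>\<^sup>+t. ennreal (?f t) \<partial>lborel)"
    using \<alpha> by (subst Gamma_conv_nn_integral_real) simp_all
  also have "\<dots> = ennreal \<beta> * (\<integral>\<^sup>+y. ennreal (?f (0 + \<beta> * y)) \<partial>lborel)"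
    using \<beta> by (subst nn_integral_real_affine[where c = \<beta> and t = 0]) simp_all
  also have "\<dots> = ennreal \<beta> * (\<integral>\<^sup>+y. ennreal ?K * ennreal (gamma_density \<alpha> \<beta> y * y ^ m) \<partial>lborel)"
    unfolding point using K by (subst ennreal_mult') (simp_all only: less_imp_le)
  also have "\<dots> = ennreal \<beta> * (ennreal ?K * (\<integral>\<^sup>+y. ennreal (gamma_density \<alpha> \<beta> y * y ^ m) \<partial>lborel))"
    unfolding gamma_density_def by (subst nn_integral_cmult) simp_all
  also have "\<dots> = ennreal (\<beta> * ?K) * (\<integral>\<^sup>+y. ennreal (gamma_density \<alpha> \<beta> y * y ^ m) \<partial>lborel)"
    using \<beta> K by (subst ennreal_mult') (simp_all add: mult.assoc)
  finally have "ennreal (1 / (\<beta> * ?K)) * ennreal (Gamma (\<alpha> + real m)) =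
      ennreal (1 / (\<beta> * ?K)) * ennreal (\<beta> * ?K) * (\<integral>\<^sup>+y. ennreal (gamma_density \<alpha> \<beta> y * y ^ m) \<partial>lborel)"
    by (simp only: mult.assoc)
  moreover have "ennreal (1 / (\<beta> * ?K)) * ennreal (\<beta> * ?K) = 1"
    using \<beta> \<Gamma> by (subst ennreal_mult'[symmetric]) simp_all
  moreover have "1 / (\<beta> * ?K) * Gamma (\<alpha> + real m) = pochhammer \<alpha> m / \<beta> ^ m"
    using \<alpha> \<beta> \<Gamma> by (subst pochhammer_Gamma) (auto simp: field_simps elim!: nonpos_Ints_cases)
  then have "ennreal (1 / (\<beta> * ?K)) * ennreal (Gamma (\<alpha> + real m)) = ennreal (pochhammer \<alpha> m / \<beta> ^ m)"
    using \<Gamma>m by (subst ennreal_mult''[symmetric]) simp_all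
  ultimately show "(\<integral>\<^sup>+y. ennreal (gamma_density \<alpha> \<beta> y * y ^ m) \<partial>lborel) = ennreal (pochhammer \<alpha> m / \<beta> ^ m)"
    by simp
qed

lemma
  assumes \<alpha>: "\<alpha> > 0" and \<beta>: "\<beta> > 0"
    and D: "distributed M lborel Y (\<lambda>y. ennreal (gamma_density \<alpha> \<beta> y))"
  shows integrable_gamma_power: "integrable M (\<lambda>\<omega>. Y \<omega> ^ m)"
    and integral_gamma_power: "(\<integral>\<omega>. Y \<omega> ^ m \<partial>M) = pochhammer \<alpha> m / \<beta> ^ m"
proof -
  note moment = has_bochner_integral_gamma_density_power[OF \<alpha> \<beta>, of m]
  show "integrable M (\<lambda>\<omega>. Y \<omega> ^ m)"
    using distributed_integrable[OF D, of "\<lambda>y. y ^ m"] moment gamma_density_nonneg[OF \<alpha> \<beta>]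
    by (simp add: has_bochner_integral_iff)
  show "(\<integral>\<omega>. Y \<omega> ^ m \<partial>M) = pochhammer \<alpha> m / \<beta> ^ m"
    using distributed_integral[OF D, of "\<lambda>y. y ^ m"] moment gamma_density_nonneg[OF \<alpha> \<beta>]
    by (simp add: has_bochner_integral_iff)
qed

text \<open>
  The rising factorials in the moments are, up to sign, the falling factorials of \<open>-\<alpha>\<close>, that is, the
  coefficients of \<open>(1 + t) powr (-\<alpha>)\<close>.
\<close>

lemma e_Y_gamma:
  assumes "\<alpha> > 0" and "\<beta> > 0"
    and "distributed M lborel Y (\<lambda>y. ennreal (gamma_density \<alpha> \<beta> y))"
  shows "e_Y M Y = fps_scale 1 (- (1 / \<beta>)) (fps_binomial (- \<alpha>) - 1)"
proof (rule fps_ext)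
  fix n
  have "pochhammer \<alpha> n / \<beta> ^ n / fact n = (- (1 / \<beta>)) ^ n * fps_nth (fps_binomial (- \<alpha>)) n"
    unfolding pochhammer_eq_falling fps_binomial_nth_falling[symmetric]
    by (simp add: power_minus[of "1 / \<beta>"] power_one_over del: fps_binomial_nth)
  then show "fps_nth (e_Y M Y) n = fps_nth (fps_scale 1 (- (1 / \<beta>)) (fps_binomial (- \<alpha>) - 1)) n"
    by (simp add: e_Y_def integral_gamma_power[OF assms])
qed

text \<open>Solving \<open>s = (1 - t/\<beta>) powr (-\<alpha>) - 1\<close> for \<open>t\<close> gives \<open>t = -\<beta> ((1 + s) powr (-1/\<alpha>) - 1)\<close>.\<close>

lemma fps_inv_gamma:
  assumes "\<alpha> \<noteq> 0" and "\<beta> \<noteq> 0"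
  shows "fps_inv (fps_scale 1 (- (1 / \<beta>)) (fps_binomial (- \<alpha>) - 1)) =
    fps_scale (- \<beta>) 1 (fps_binomial (- (1 / \<alpha>)) - 1)"
proof (rule fps_inv_unique)
  let ?F = "fps_scale 1 (- (1 / \<beta>)) (fps_binomial (- \<alpha>) - 1)"
  let ?G = "fps_scale (- \<beta>) 1 (fps_binomial (- (1 / \<alpha>)) - 1)"
  have "(fps_binomial (- (1 / \<alpha>)) - 1) oo (fps_binomial (- \<alpha>) - 1) = fps_X"
    using assms by (simp add: fps_compose_sub_distrib fps_binomial_compose fps_binomial_1)
  then show "?G oo ?F = fps_X"
    using fps_scale_compose_scale[of "fps_binomial (- \<alpha>) - 1" 1 "- \<beta>"
        "fps_binomial (- (1 / \<alpha>)) - 1" "- (1 / \<beta>)"] assms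
    by (simp add: fps_scale_X)
  show "fps_nth ?F 0 = 0" and "fps_nth ?F 1 \<noteq> 0"
    using assms by simp_all
qed

section \<open>Probabilistic Stirling numbers of the gamma distribution\<close>

lemma S2_prob_gamma:
  assumes "\<alpha> > 0" and "\<beta> > 0"
    and "distributed M lborel Y (\<lambda>y. ennreal (gamma_density \<alpha> \<beta> y))"
  shows "S2_prob M Y n k = 1 / (fact k * \<beta> ^ n) *
    (\<Sum>j=0..k. real (k choose j) * (- 1) ^ (k - j) * falling (\<alpha> * real j + real n - 1) n)"
  unfolding S2_prob_def e_Y_gamma[OF assms] stirling_coeff_scale stirling_coeff_binomial falling_reflect
  by (simp add: power_minus[of "1 / \<beta>"] power_one_over sum_distrib_left mult_ac)

lemma S1_prob_gamma:
  assumes "\<alpha> > 0" and "\<beta> > 0"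
    and "distributed M lborel Y (\<lambda>y. ennreal (gamma_density \<alpha> \<beta> y))"
  shows "S1_prob M Y n k = 1 / fact k * \<beta> ^ k * (- (1 / \<alpha>)) ^ n *
    (\<Sum>j=0..k. real (k choose j) * (- 1) ^ j * falling_step \<alpha> (real j + (real n - 1) * \<alpha>) n)"
proof -
  have inv: "fps_inv (e_Y M Y) = fps_scale (- \<beta>) 1 (fps_binomial (- (1 / \<alpha>)) - 1)"
    unfolding e_Y_gamma[OF assms] using assms by (intro fps_inv_gamma) simp_all
  have term_eq: "(- \<beta>) ^ k * (real (k choose j) * (- 1) ^ (k - j) * falling (- (1 / \<alpha>) * real j) n) =
      \<beta> ^ k * (- (1 / \<alpha>)) ^ n *
        (real (k choose j) * (- 1) ^ j * falling_step \<alpha> (real j + (real n - 1) * \<alpha>) n)"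
    if "j \<le> k" for j
  proof -
    have "(- \<beta>) ^ k * (- 1) ^ (k - j) = \<beta> ^ k * ((- 1) ^ k * (- 1) ^ (k - j))"
      by (simp add: power_minus[of \<beta>])
    also have "(- 1 :: real) ^ k * (- 1) ^ (k - j) = (- 1) ^ j"
      using that by (simp add: minus_one_power_iff)
    finally have sign: "(- \<beta>) ^ k * (- 1) ^ (k - j) = \<beta> ^ k * (- 1) ^ j" .
    have "(- (1 / \<alpha>)) ^ n * (- \<alpha>) ^ n = 1"
      using assms(1) by (simp flip: power_mult_distrib)
    then have refl: "falling (- (1 / \<alpha>) * real j) n =
        (- (1 / \<alpha>)) ^ n * falling_step \<alpha> (real j + (real n - 1) * \<alpha>) n"
      using assms(1) by (simp add: falling_step_reflect flip: mult.assoc)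
    show ?thesis
      unfolding refl using sign by (simp add: mult_ac)
  qed
  have "S1_prob M Y n k = 1 / fact k *
      (\<Sum>j=0..k. (- \<beta>) ^ k * (real (k choose j) * (- 1) ^ (k - j) * falling (- (1 / \<alpha>) * real j) n))"
    unfolding S1_prob_def inv stirling_coeff_scale stirling_coeff_binomial sum_distrib_left[symmetric]
    by simp
  also have "\<dots> = 1 / fact k * (\<Sum>j=0..k. \<beta> ^ k * (- (1 / \<alpha>)) ^ n *
      (real (k choose j) * (- 1) ^ j * falling_step \<alpha> (real j + (real n - 1) * \<alpha>) n))"
    by (intro arg_cong2[where f = "(*)"] sum.cong refl term_eq) simp
  finally show ?thesis
    by (simp only: sum_distrib_left[symmetric] mult.assoc)
qed

text \<open>
  The two relations below hold for every \<open>Y\<close> with finite moments, since they only use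
  \<open>e\<^sub>Y\<^sub>,\<^sub>\<lambda> = e\<^sub>Y \<circ> L\<close>. In the second one a nonzero mean makes the series invertible.
\<close>

lemma S2_prob_deg_eq_sum:
  assumes "c \<noteq> 0" and "\<And>m. integrable M (\<lambda>\<omega>. Y \<omega> ^ m)"
  shows "S2_prob_deg M Y c n k = (\<Sum>l=0..n. S2_prob M Y l k * (c ^ (n - l) * S1 n l))"
  unfolding S2_prob_deg_def e_Y_deg_eq_compose[OF assms] S2_prob_def
  by (subst stirling_coeff_compose) (simp_all add: stirling_coeff_deg_log[OF assms(1)])

lemma S1_prob_deg_eq_sum:
  assumes c: "c \<noteq> 0" and int: "\<And>m. integrable M (\<lambda>\<omega>. Y \<omega> ^ m)" and mean: "(\<integral>\<omega>. Y \<omega> \<partial>M) \<noteq> 0"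
  shows "S1_prob_deg M Y c n k = (\<Sum>l=k..n. S2 l k * c ^ (l - k) * S1_prob M Y n l)"
proof -
  let ?E = "fps_scale (1 / c) c (fps_exp 1 - 1)"
  have E: "stirling_coeff ?E l k = S2 l k * c ^ (l - k)" if "k \<le> l" for l
    using that c by (simp add: stirling_coeff_scale S2_egf power_diff power_divide field_simps)
  have inv: "fps_inv (e_Y_deg M Y c) = ?E oo fps_inv (e_Y M Y)"
    unfolding e_Y_deg_eq_compose[OF c int] using mean
    by (intro fps_inv_compose_deg_log[OF c]) (simp_all add: e_Y_def)
  have "S1_prob_deg M Y c n k = (\<Sum>l=0..n. stirling_coeff ?E l k * S1_prob M Y n l)"
    unfolding S1_prob_deg_def S1_prob_def inv
    by (rule stirling_coeff_compose) (simp add: fps_inv_def)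
  also have "\<dots> = (\<Sum>l=k..n. stirling_coeff ?E l k * S1_prob M Y n l)"
    by (rule sum.mono_neutral_right) (auto simp: stirling_coeff_eq_0)
  finally show ?thesis
    by (simp add: E)
qed

theorem theorem2p6:
  fixes M :: "'a measure" and Y :: "'a \<Rightarrow> real" and \<alpha> \<beta> lam :: real and n k :: nat
  assumes "prob_space M"
    and "lam \<noteq> 0" and "\<alpha> > 0" and "\<beta> > 0"
    and "distributed M lborel Y (\<lambda>y. ennreal (gamma_density \<alpha> \<beta> y))"
    and "k \<le> n"
  shows "S2_prob M Y n k = 1 / (fact k * \<beta> ^ n) *
           (\<Sum>j=0..k. real (k choose j) * (- 1) ^ (k - j) * falling (\<alpha> * real j + real n - 1) n)
       \<and> S1_prob M Y n k = 1 / fact k * \<beta> ^ k * (- (1 / \<alpha>)) ^ n *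
           (\<Sum>j=0..k. real (k choose j) * (- 1) ^ j * falling_step \<alpha> (real j + (real n - 1) * \<alpha>) n)
       \<and> S2_prob_deg M Y lam n k =
           (\<Sum>l=0..n. \<Sum>j=0..k. (- 1) ^ (k - j) * (1 / fact k) * real (k choose j) *
              falling (\<alpha> * real j + real l - 1) l * (1 / \<beta> ^ l) * lam ^ (n - l) * S1 n l)
       \<and> S1_prob_deg M Y lam n k =
           (\<Sum>l=k..n. \<Sum>j=0..l. S2 l k * real (l choose j) * (1 / fact l) * (- 1) ^ (n - j) *
              lam ^ (l - k) * \<beta> ^ l * (1 / \<alpha> ^ n) * falling_step \<alpha> (real j + (real n - 1) * \<alpha>) n)"
proof -
  note gamma = \<open>\<alpha> > 0\<close> \<open>\<beta> > 0\<close> assms(5)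
  note int = integrable_gamma_power[OF gamma]
  have mean: "(\<integral>\<omega>. Y \<omega> \<partial>M) \<noteq> 0"
    using integral_gamma_power[OF gamma, of 1] \<open>\<alpha> > 0\<close> \<open>\<beta> > 0\<close> by simp
  have "S2_prob_deg M Y lam n k =
      (\<Sum>l=0..n. \<Sum>j=0..k. (- 1) ^ (k - j) * (1 / fact k) * real (k choose j) *
         falling (\<alpha> * real j + real l - 1) l * (1 / \<beta> ^ l) * lam ^ (n - l) * S1 n l)"
    unfolding S2_prob_deg_eq_sum[OF \<open>lam \<noteq> 0\<close> int] S2_prob_gamma[OF gamma]
    by (simp add: sum_distrib_left sum_distrib_right sum_divide_distrib mult_ac)
  moreover have "S1_prob_deg M Y lam n k =
      (\<Sum>l=k..n. \<Sum>j=0..l. S2 l k * real (l choose j) * (1 / fact l) * (- 1) ^ (n - j) *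
         lam ^ (l - k) * \<beta> ^ l * (1 / \<alpha> ^ n) * falling_step \<alpha> (real j + (real n - 1) * \<alpha>) n)"
    unfolding S1_prob_deg_eq_sum[OF \<open>lam \<noteq> 0\<close> int mean] S1_prob_gamma[OF gamma] sum_distrib_left
  proof (intro sum.cong refl)
    fix l j assume "l \<in> {k..n}" and "j \<in> {0..l}"
    then have "(- 1 :: real) ^ (n - j) = (- 1) ^ n * (- 1) ^ j"
      by (simp add: minus_one_power_iff)
    moreover have "(- (1 / \<alpha>)) ^ n = (- 1) ^ n * (1 / \<alpha> ^ n)"
      by (simp add: power_minus[of "1 / \<alpha>"] power_one_over)
    ultimately show "S2 l k * lam ^ (l - k) * (1 / fact l * \<beta> ^ l * (- (1 / \<alpha>)) ^ n *
          (real (l choose j) * (- 1) ^ j * falling_step \<alpha> (real j + (real n - 1) * \<alpha>) n)) =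
        S2 l k * real (l choose j) * (1 / fact l) * (- 1) ^ (n - j) *
          lam ^ (l - k) * \<beta> ^ l * (1 / \<alpha> ^ n) * falling_step \<alpha> (real j + (real n - 1) * \<alpha>) n"
      by (simp add: mult_ac)
  qed
  ultimately show ?thesis
    using S2_prob_gamma[OF gamma] S1_prob_gamma[OF gamma] by blast
qed

end
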